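(* Let $G$ be a group, regarded as a semigroup under its multiplication. Then $G/\sigma_{orient} = G/[G,G]$, the abelianization of $G$. That is, for every $g\in G$ the $\sigma_{orient}$-class of $g$ coincides, as a subset of $G$, with the class of $g$ in $G/[G,G]$ (the set of $h \in G$ with $gh^{-1}\in[G,G]$), so that the two quotients of $G$ are the same.
   Context: Let $S$ be a semigroup (a set with an associative binary operation) and let $t_1,t_2\notin S$ be two variable symbols. A two-variable simple equation over $S$ is an expression $a\,t_1\,b = c\,t_2\,d$, where each of $a,b,c,d$ is either an element of $S$ or empty (i.e. absent from the expression); some or all of them may be empty. An ordered pair $(u,v)\in S\times S$ satisfies the equation if $aub = cvd$ holds in $S$ (with empty coefficients simply omitted from the products). The equation $at_1b=ct_2d$ is called a two-variable orientable equation over $S$ if there are elements $x_1,\dots,x_n$ of $S$ (not necessarily distinct) and factorizations in $S$ $$a=\prod_{i=1}^{n_1}a_i,\qquad b=\prod_{j=1}^{n_2}b_j,\qquad c=\prod_{k=1}^{n_3}c_k,\qquad d=\prod_{l=1}^{n_4}d_l,$$ with all factors elements of $S$, such that $n_1+n_2+n_3+n_4=2n$, $n_1+n_2=n_3+n_4$, and each $x_\nu$ ($1\le\nu\le n$) occurs once among $a_1,\dots,a_{n_1},b_1,\dots,b_{n_2}$ and once among $c_1,\dots,c_{n_3},d_1,\dots,d_{n_4}$. In other words, the lists $(a_1,\dots,a_{n_1},b_1,\dots,b_{n_2})$ and $(c_1,\dots,c_{n_3},d_1,\dots,d_{n_4})$ are both rearrangements of the list $(x_1,\dots,x_n)$,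 i.e. they agree as multisets. A product with zero factors is understood to be empty, so a coefficient is empty exactly when its number of factors is $0$. For $u,v\in S$, write $u\,\sigma_{orient}\,v$ if the ordered pair $(u,v)$ satisfies some two-variable orientable equation over $S$. It is known from earlier work that $\sigma_{orient}$ is a congruence on every semigroup $S$; $S/\sigma_{orient}$ denotes the quotient semigroup of $\sigma_{orient}$-classes. The commutator subgroup $[G,G]$ of a group $G$ is the smallest subgroup of $G$ containing all elements $xyx^{-1}y^{-1}$ with $x,y\in G$. It is normal, and $G/[G,G]$ is the quotient of $G$ by the congruence $g\sim h \iff gh^{-1}\in[G,G]$. *)

theory Defs
  imports "HOL-Algebra.Generated_Groups" "HOL-Library.Multiset"
begin

text \<open>
  A semigroup is given by its carrier set \<open>S\<close> and its multiplication \<open>m\<close>; no unit element is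
  involved in any of the definitions. A coefficient of an equation is either an element of the
  semigroup (\<open>Some a\<close>) or absent (\<open>None\<close>).
\<close>

text \<open>\<open>Simple_Eq a b c d\<close> is the expression \<open>a t1 b = c t2 d\<close>.\<close>

datatype 'a simple_eq = Simple_Eq "'a option" "'a option" "'a option" "'a option"

fun simple_eq_over :: "'a set \<Rightarrow> 'a simple_eq \<Rightarrow> bool" where
  "simple_eq_over S (Simple_Eq a b c d) \<longleftrightarrow>
     set_option a \<subseteq> S \<and> set_option b \<subseteq> S \<and> set_option c \<subseteq> S \<and> set_option d \<subseteq> S"

fun coeff_left :: "('a \<Rightarrow> 'a \<Rightarrow> 'a) \<Rightarrow> 'a option \<Rightarrow> 'a \<Rightarrow> 'a" where
  "coeff_left m None u = u"
| "coeff_left m (Some a) u = m a u"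

fun coeff_right :: "('a \<Rightarrow> 'a \<Rightarrow> 'a) \<Rightarrow> 'a \<Rightarrow> 'a option \<Rightarrow> 'a" where
  "coeff_right m u None = u"
| "coeff_right m u (Some b) = m u b"

fun satisfies_eq :: "('a \<Rightarrow> 'a \<Rightarrow> 'a) \<Rightarrow> 'a \<Rightarrow> 'a \<Rightarrow> 'a simple_eq \<Rightarrow> bool" where
  "satisfies_eq m u v (Simple_Eq a b c d) \<longleftrightarrow>
     coeff_right m (coeff_left m a u) b = coeff_right m (coeff_left m c v) d"

text \<open>The product of a list of factors; it is absent exactly when there are no factors.\<close>

fun factors_prod :: "('a \<Rightarrow> 'a \<Rightarrow> 'a) \<Rightarrow> 'a list \<Rightarrow> 'a option" where
  "factors_prod m [] = None"
| "factors_prod m (x # xs) = Some (foldl m x xs)"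

text \<open>
  The two multiset equations say that each entry of the list \<open>xs = [x1, ..., xn]\<close> occurs once
  among the factors on either side of the equation. They entail the length conditions
  \<open>n1 + n2 = n3 + n4\<close> and \<open>n1 + n2 + n3 + n4 = 2 n\<close>.
\<close>

fun orientable_eq :: "'a set \<Rightarrow> ('a \<Rightarrow> 'a \<Rightarrow> 'a) \<Rightarrow> 'a simple_eq \<Rightarrow> bool" where
  "orientable_eq S m (Simple_Eq a b c d) \<longleftrightarrow>
     simple_eq_over S (Simple_Eq a b c d) \<and>
     (\<exists>xs as bs cs ds.
        set xs \<subseteq> S \<and> set as \<subseteq> S \<and> set bs \<subseteq> S \<and> set cs \<subseteq> S \<and> set ds \<subseteq> S \<and>
        a = factors_prod m as \<and> b = factors_prod m bs \<and>
        c = factors_prod m cs \<and> d = factors_prod m ds \<and>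
        mset (as @ bs) = mset xs \<and> mset (cs @ ds) = mset xs)"

definition sigma_orient :: "'a set \<Rightarrow> ('a \<Rightarrow> 'a \<Rightarrow> 'a) \<Rightarrow> ('a \<times> 'a) set" where
  "sigma_orient S m =
     {(u, v). u \<in> S \<and> v \<in> S \<and> (\<exists>E. orientable_eq S m E \<and> satisfies_eq m u v E)}"

text \<open>
  Multiplication of the classes of a congruence \<open>r\<close>: the union is that of the classes of the
  products of all representatives, which all coincide when \<open>r\<close> is a congruence. The carrier of
  the quotient semigroup is \<open>S // r\<close>.
\<close>

definition class_mult :: "('a \<Rightarrow> 'a \<Rightarrow> 'a) \<Rightarrow> ('a \<times> 'a) set \<Rightarrow> 'a set \<Rightarrow> 'a set \<Rightarrow> 'a set" where
  "class_mult m r X Y = (\<Union>x\<in>X. \<Union>y\<in>Y. r `` {m x y})"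

end

theory Submission
  imports Defs "HOL-Algebra.Divisibility"
begin

text \<open>
  In the abelianization the two coefficient products of an orientable equation agree, since they
  have the same factors; so a solution \<open>(u, v)\<close> has equal cosets. Conversely, every element of
  the commutator subgroup is the product of a list some rearrangement of which has product \<open>\<one>\<close>:
  for a commutator, \<open>[x, y, inv x, inv y]\<close> is a rearrangement of \<open>[x, inv x, y, inv y]\<close>. Hence
  if \<open>g = k \<otimes> h\<close> with \<open>k\<close> such a product, then \<open>(g, h)\<close> solves the equation whose left
  coefficients have these two lists of factors.
\<close>

text \<open>Unlike \<open>factors_prod\<close>, this gives the empty list the value \<one>, so empty
  and nonempty coefficients are treated alike. The \<open>foldr\<close> form is the one in which
  \<open>multlist_closed\<close> and \<open>multlist_perm_cong\<close> are stated.\<close>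

abbreviation list_mult :: "('a, 'b) monoid_scheme \<Rightarrow> 'a list \<Rightarrow> 'a" where
  "list_mult G xs \<equiv> foldr (\<otimes>\<^bsub>G\<^esub>) xs \<one>\<^bsub>G\<^esub>"

lemma (in monoid) list_mult_append:
  assumes "set xs \<subseteq> carrier G" "set ys \<subseteq> carrier G"
  shows "list_mult G (xs @ ys) = list_mult G xs \<otimes> list_mult G ys"
  using assms by (induction xs) (auto simp: m_assoc)

lemma (in monoid) foldl_mult_eq:
  assumes "x \<in> carrier G" "set xs \<subseteq> carrier G"
  shows "foldl (\<otimes>) x xs = x \<otimes> list_mult G xs"
  using assms by (induction xs arbitrary: x) (auto simp: m_assoc)

lemma (in monoid) coeff_left_factors_prod:
  assumes "set xs \<subseteq> carrier G" "u \<in> carrier G"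
  shows "coeff_left (\<otimes>) (factors_prod (\<otimes>) xs) u = list_mult G xs \<otimes> u"
  using assms by (cases xs) (auto simp: foldl_mult_eq)

lemma (in monoid) coeff_right_factors_prod:
  assumes "set xs \<subseteq> carrier G" "u \<in> carrier G"
  shows "coeff_right (\<otimes>) u (factors_prod (\<otimes>) xs) = u \<otimes> list_mult G xs"
  using assms by (cases xs) (auto simp: foldl_mult_eq)

text \<open>An absent coefficient acts like the unit of a monoid, so the case distinction on
  \<open>None\<close> disappears and an equation becomes an identity between products.\<close>

lemma (in monoid) satisfies_factors_prod_iff:
  assumes "set as \<subseteq> carrier G" "set bs \<subseteq> carrier G" "set cs \<subseteq> carrier G" "set ds \<subseteq> carrier G"
    and "u \<in> carrier G" "v \<in> carrier G"
  shows "satisfies_eq (\<otimes>) u v (Simple_Eq (factors_prod (\<otimes>) as) (factors_prod (\<otimes>) bs)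
           (factors_prod (\<otimes>) cs) (factors_prod (\<otimes>) ds)) \<longleftrightarrow>
         list_mult G as \<otimes> u \<otimes> list_mult G bs = list_mult G cs \<otimes> v \<otimes> list_mult G ds"
  using assms by (simp add: coeff_left_factors_prod coeff_right_factors_prod)

lemma (in monoid) factors_prod_in_carrier:
  "set xs \<subseteq> carrier G \<Longrightarrow> set_option (factors_prod (\<otimes>) xs) \<subseteq> carrier G"
  by (cases xs) (auto simp: foldl_mult_eq)

lemma (in group_hom) hom_list_mult:
  "set xs \<subseteq> carrier G \<Longrightarrow> h (list_mult G xs) = list_mult H (map h xs)"
  by (induction xs) auto

text \<open>In a commutative group the images of all factors on one side can be gathered into one
  product. Both sides have the same multiset of factors, so these products agree and cancel. Applied
  below to the projection onto \<open>G Mod derived G (carrier G)\<close>.\<close>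

lemma (in group) sigma_orient_hom_eq:
  assumes "comm_group H" and hom: "f \<in> hom G H"
    and uv: "(u, v) \<in> sigma_orient (carrier G) (\<otimes>)"
  shows "f u = f v"
proof -
  interpret H: comm_group H by fact
  interpret f: group_hom G H f by unfold_locales (rule hom)
  from uv obtain a b c d where u: "u \<in> carrier G" and v: "v \<in> carrier G"
    and or: "orientable_eq (carrier G) (\<otimes>) (Simple_Eq a b c d)"
    and sat: "satisfies_eq (\<otimes>) u v (Simple_Eq a b c d)"
  proof -
    from uv obtain E where "u \<in> carrier G" "v \<in> carrier G"
      "orientable_eq (carrier G) (\<otimes>) E" "satisfies_eq (\<otimes>) u v E"
      unfolding sigma_orient_def by blast
    with that show ?thesis by (cases E) blast
  qed
  from or obtain as bs cs ds where
    sets: "set as \<subseteq> carrier G" "set bs \<subseteq> carrier G" "set cs \<subseteq> carrier G" "set ds \<subseteq> carrier G"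
    and eqs: "a = factors_prod (\<otimes>) as" "b = factors_prod (\<otimes>) bs"
      "c = factors_prod (\<otimes>) cs" "d = factors_prod (\<otimes>) ds"
    and ms: "mset (as @ bs) = mset (cs @ ds)"
    by auto
  have fu: "f u \<in> carrier H" and fv: "f v \<in> carrier H"
    using u v by auto
  have f_sets: "set (map f xs) \<subseteq> carrier H" if "set xs \<subseteq> carrier G" for xs
    using that by auto
  let ?P = "\<lambda>xs. list_mult H (map f xs)"
  have P_closed: "?P xs \<in> carrier H" if "set xs \<subseteq> carrier G" for xs
    using f_sets[OF that] by (rule H.multlist_closed)
  \<comment> \<open>Commutativity of \<open>H\<close> moves the right coefficient past
    \<open>f w\<close>, so that only the concatenated list matters.\<close>
  have split: "f (list_mult G xs \<otimes> w \<otimes> list_mult G ys) = ?P (xs @ ys) \<otimes>\<^bsub>H\<^esub> f w"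
    if "set xs \<subseteq> carrier G" "set ys \<subseteq> carrier G" "w \<in> carrier G" for xs ys w
  proof -
    have "f (list_mult G xs \<otimes> w \<otimes> list_mult G ys) = ?P xs \<otimes>\<^bsub>H\<^esub> f w \<otimes>\<^bsub>H\<^esub> ?P ys"
      using that by (simp add: f.hom_list_mult)
    also have "\<dots> = ?P xs \<otimes>\<^bsub>H\<^esub> ?P ys \<otimes>\<^bsub>H\<^esub> f w"
      using that P_closed by (simp add: H.m_ac)
    also have "?P xs \<otimes>\<^bsub>H\<^esub> ?P ys = ?P (xs @ ys)"
      using H.list_mult_append[OF f_sets f_sets] that by (simp del: foldr_append)
    finally show ?thesis .
  qed
  have "list_mult G as \<otimes> u \<otimes> list_mult G bs = list_mult G cs \<otimes> v \<otimes> list_mult G ds"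
    using sat satisfies_factors_prod_iff[OF sets u v] eqs by simp
  then have "?P (as @ bs) \<otimes>\<^bsub>H\<^esub> f u = ?P (cs @ ds) \<otimes>\<^bsub>H\<^esub> f v"
    using split sets u v by metis
  moreover have "?P (as @ bs) = ?P (cs @ ds)"
  proof (rule H.multlist_perm_cong)
    show "mset (map f (as @ bs)) = mset (map f (cs @ ds))"
      by (simp only: mset_map ms)
  qed (rule f_sets, use sets in simp)
  moreover have "?P (cs @ ds) \<in> carrier H"
    using sets by (intro P_closed) simp
  ultimately show ?thesis using fu fv by simp
qed

lemma (in group) commutator_lists:
  assumes "x \<in> carrier G" "y \<in> carrier G"
  shows "\<exists>xs ys. set xs \<subseteq> carrier G \<and> set ys \<subseteq> carrier G \<and> mset xs = mset ys \<and>
           list_mult G xs = x \<otimes> y \<otimes> inv x \<otimes> inv y \<and> list_mult G ys = \<one>"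
proof (intro exI conjI)
  show "mset [x, y, inv x, inv y] = mset [x, inv x, y, inv y]" by simp
qed (use assms in \<open>auto simp: m_assoc r_inv\<close>)

lemma (in group) derived_lists:
  assumes "k \<in> derived G (carrier G)"
  shows "\<exists>xs ys. set xs \<subseteq> carrier G \<and> set ys \<subseteq> carrier G \<and> mset xs = mset ys \<and>
           list_mult G xs = k \<and> list_mult G ys = \<one>"
  using assms unfolding derived_def
proof (induction rule: generate.induct)
  case one
  show ?case by (intro exI[of _ "[]"]) simp
next
  case (incl h)
  then show ?case using commutator_lists by auto
next
  case (inv h)
  then obtain x y where xy: "x \<in> carrier G" "y \<in> carrier G" "h = x \<otimes> y \<otimes> inv x \<otimes> inv y"
    by auto
  \<comment> \<open>\<open>generate\<close> adds inverses of generators only, and the inverse of the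
    commutator of \<open>x\<close> and \<open>y\<close> is the commutator of \<open>y\<close> and
    \<open>x\<close>.\<close>
  then have "inv h = y \<otimes> x \<otimes> inv y \<otimes> inv x"
    by (simp add: inv_mult_group m_assoc)
  then show ?case using commutator_lists[of y x] xy by simp
next
  case (eng h1 h2)
  then obtain xs1 ys1 xs2 ys2 where
    "set xs1 \<subseteq> carrier G" "set ys1 \<subseteq> carrier G" "mset xs1 = mset ys1"
    "list_mult G xs1 = h1" "list_mult G ys1 = \<one>"
    "set xs2 \<subseteq> carrier G" "set ys2 \<subseteq> carrier G" "mset xs2 = mset ys2"
    "list_mult G xs2 = h2" "list_mult G ys2 = \<one>"
    by auto
  \<comment> \<open>Concatenating lists multiplies their products and adds their multisets, so both
    lists of a pair can be concatenated in parallel.\<close>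
  then have "set (xs1 @ xs2) \<subseteq> carrier G \<and> set (ys1 @ ys2) \<subseteq> carrier G \<and>
      mset (xs1 @ xs2) = mset (ys1 @ ys2) \<and>
      list_mult G (xs1 @ xs2) = h1 \<otimes> h2 \<and> list_mult G (ys1 @ ys2) = \<one>"
    by (simp add: list_mult_append del: foldr_append)
  then show ?case by blast
qed

lemma (in group) sigma_orient_iff:
  "(g, h) \<in> sigma_orient (carrier G) (\<otimes>) \<longleftrightarrow>
     g \<in> carrier G \<and> h \<in> carrier G \<and> g \<otimes> inv h \<in> derived G (carrier G)"
proof
  assume gh: "(g, h) \<in> sigma_orient (carrier G) (\<otimes>)"
  let ?D = "derived G (carrier G)"
  interpret D: normal ?D G by (rule derived_self_is_normal)
  have carr: "g \<in> carrier G" "h \<in> carrier G"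
    using gh by (auto simp: sigma_orient_def)
  \<comment> \<open>The homomorphism is the projection of \<open>G\<close> onto its quotient by
    \<open>?D\<close>, which is commutative.\<close>
  have "?D #> g = ?D #> h"
    using sigma_orient_hom_eq[OF derived_quot_is_comm_group D.r_coset_hom_Mod gh] .
  then have "g \<in> ?D #> h"
    using rcos_self[OF carr(1) D.subgroup_axioms] by simp
  then show "g \<in> carrier G \<and> h \<in> carrier G \<and> g \<otimes> inv h \<in> ?D"
    using D.rcos_module_imp[OF group_axioms carr(2)] carr by simp
next
  assume gh: "g \<in> carrier G \<and> h \<in> carrier G \<and> g \<otimes> inv h \<in> derived G (carrier G)"
  then obtain xs ys where sets: "set xs \<subseteq> carrier G" "set ys \<subseteq> carrier G"
    and ms: "mset xs = mset ys"
    and prods: "list_mult G xs = g \<otimes> inv h" "list_mult G ys = \<one>"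
    using derived_lists by blast
  \<comment> \<open>With both right coefficients absent, the equation at \<open>(g, h)\<close> reads
    \<one> \<otimes> g = (g \<otimes> inv h) \<otimes> h.\<close>
  let ?E = "Simple_Eq (factors_prod (\<otimes>) ys) (factors_prod (\<otimes>) [])
              (factors_prod (\<otimes>) xs) (factors_prod (\<otimes>) [])"
  have "satisfies_eq (\<otimes>) g h ?E"
    using gh sets by (subst satisfies_factors_prod_iff) (auto simp: prods m_assoc)
  moreover have "orientable_eq (carrier G) (\<otimes>) ?E"
    unfolding orientable_eq.simps
  proof (intro conjI exI)
    show "mset (ys @ []) = mset ys" "mset (xs @ []) = mset ys" using ms by simp_all
  qed (use sets factors_prod_in_carrier in auto)
  ultimately show "(g, h) \<in> sigma_orient (carrier G) (\<otimes>)"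
    using gh unfolding sigma_orient_def by blast
qed

lemma (in group) sigma_orient_class:
  assumes "g \<in> carrier G"
  shows "sigma_orient (carrier G) (\<otimes>) `` {g} = derived G (carrier G) #> g"
proof -
  let ?D = "derived G (carrier G)"
  interpret D: normal ?D G by (rule derived_self_is_normal)
  have "g \<otimes> inv h \<in> ?D \<longleftrightarrow> h \<in> ?D #> g" if "h \<in> carrier G" for h
  proof -
    \<comment> \<open>Membership in the coset of \<open>g\<close> is expressed by
      \<open>h \<otimes> inv g\<close>, the inverse of the element that occurs in
      \<open>sigma_orient_iff\<close>; a subgroup contains both or neither.\<close>
    have "inv (g \<otimes> inv h) = h \<otimes> inv g" "inv (h \<otimes> inv g) = g \<otimes> inv h"
      using assms that by (simp_all add: inv_mult_group)
    then have "g \<otimes> inv h \<in> ?D \<longleftrightarrow> h \<otimes> inv g \<in> ?D"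
      by (metis D.m_inv_closed)
    then show ?thesis
      using D.rcos_module[OF group_axioms assms that] by simp
  qed
  moreover have "?D #> g \<subseteq> carrier G"
    using assms by (simp add: r_coset_subset_G D.subset)
  ultimately show ?thesis
    using assms by (auto simp: sigma_orient_iff)
qed

theorem theorem2p2:
  fixes G :: "('a, 'b) monoid_scheme"
  assumes "group G"
  shows "(\<forall>g \<in> carrier G.
            sigma_orient (carrier G) (monoid.mult G) `` {g} =
            {h \<in> carrier G. g \<otimes>\<^bsub>G\<^esub> inv\<^bsub>G\<^esub> h \<in> derived G (carrier G)}) \<and>
         carrier G // sigma_orient (carrier G) (monoid.mult G) =
           carrier (G Mod derived G (carrier G)) \<and>
         (\<forall>X \<in> carrier G // sigma_orient (carrier G) (monoid.mult G).
          \<forall>Y \<in> carrier G // sigma_orient (carrier G) (monoid.mult G).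
            class_mult (monoid.mult G) (sigma_orient (carrier G) (monoid.mult G)) X Y =
            X \<otimes>\<^bsub>G Mod derived G (carrier G)\<^esub> Y)"
proof -
  interpret group G by fact
  let ?D = "derived G (carrier G)" and ?s = "sigma_orient (carrier G) (monoid.mult G)"
  interpret D: normal ?D G by (rule derived_self_is_normal)
  have quot: "carrier G // ?s = rcosets\<^bsub>G\<^esub> ?D"
    by (auto simp: quotient_def RCOSETS_def sigma_orient_class)
  have "class_mult (monoid.mult G) ?s X Y = X <#>\<^bsub>G\<^esub> Y"
    if "X \<in> carrier G // ?s" "Y \<in> carrier G // ?s" for X Y
  proof -
    from that obtain g h where g: "g \<in> carrier G" "X = ?D #>\<^bsub>G\<^esub> g"
      and h: "h \<in> carrier G" "Y = ?D #>\<^bsub>G\<^esub> h"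
      unfolding quot RCOSETS_def by auto
    have XY: "X \<subseteq> carrier G" "Y \<subseteq> carrier G"
      using g h by (simp_all add: r_coset_subset_G D.subset)
    \<comment> \<open>Nonemptiness matters: all sets in the union defining \<open>class_mult\<close>
      turn out equal, but a union over an empty index set would be empty.\<close>
    have ne: "g \<in> X" "h \<in> Y"
      using g h rcos_self D.subgroup_axioms by auto
    \<comment> \<open>Any \<open>x\<close> in \<open>X\<close> and \<open>y\<close> in
      \<open>Y\<close> represent these cosets, so the class of their product is the product of the
      cosets, by normality of \<open>?D\<close>.\<close>
    have "?s `` {x \<otimes>\<^bsub>G\<^esub> y} = X <#>\<^bsub>G\<^esub> Y" if "x \<in> X" "y \<in> Y" for x y
    proof -
      have "x \<in> carrier G" "y \<in> carrier G" using that XY by auto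
      moreover have "X = ?D #>\<^bsub>G\<^esub> x" "Y = ?D #>\<^bsub>G\<^esub> y"
        using that g h repr_independence D.subgroup_axioms by auto
      ultimately show ?thesis
        by (simp add: sigma_orient_class D.rcos_sum)
    qed
    then show ?thesis
      using ne unfolding class_mult_def by blast
  qed
  then show ?thesis
    using quot by (auto simp: sigma_orient_iff FactGroup_def)
qed

end
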